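(* Let $P$ be a finite ranked poset with least and greatest elements, and let $b(P)=\sum_{x\in P}\operatorname{rank} x$. The number of quilts of type $(P,C_n)$, for integers $n\ge \operatorname{rank}P$, is given by a polynomial in $n$ of degree $b(P)$; that is, there is a polynomial $p$ of degree $b(P)$ with $|\mathrm{Quilts}(P,C_n)|=p(n)$ for all integers $n\geq \operatorname{rank} P$. Furthermore, the leading coefficient of this polynomial is $\dfrac{|S(P)|}{b(P)!}$, where $S(P)$ is the set of standard quilts for $P$.
   Context: $\mathbb N=\{0,1,2,\dots\}$, $[m]=\{1,\dots,m\}$. All posets are finite, ranked (all maximal chains have the same size), and have a least element $\hat 0$ and a greatest element $\hat 1$. $x\lessdot y$ means $y$ covers $x$. The rank function satisfies $\operatorname{rank}\hat 0=0$ and $\operatorname{rank}y=\operatorname{rank}x+1$ if $x\lessdot y$; $\operatorname{rank}P=\operatorname{rank}\hat 1_P$. $C_n$ is the chain $\{0<1<\dots<n\}$. $P\times Q$ carries the product order. A quilt of type $(P,Q)$ is a map $f:P\times Q\to\mathbb N$ such that: (i) $f(x,y)=0$ whenever $x=\hat 0_P$ or $y=\hat 0_Q$; (ii) $f(\hat 1_P,\hat 1_Q)=\min\{\operatorname{rank}P,\operatorname{rank}Q\}$; (iii) if $(x,y)\lessdot(x',y')$ in $P\times Q$, then $f(x',y')\in\{f(x,y),f(x,y)+1\}$. $\mathrm{Quilts}(P,Q)$ is the set of all quilts of type $(P,Q)$. For $f\in\mathrm{Quilts}(P,C_{b(P)})$, an element $i\in[b(P)]$ is a jump for $f$ if there is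 $x\in P$ with $f(x,i)=f(x,i-1)+1$. A quilt $f\in \mathrm{Quilts}(P,C_{b(P)})$ is standard if its set of jumps is all of $[b(P)]$; $S(P)$ is the set of standard quilts for $P$. *)

theory Defs
  imports
    "HOL-Library.FuncSet"
    "HOL-Library.Product_Order"
    "HOL-Computational_Algebra.Polynomial"
begin

text \<open>
  A poset is a subset \<open>P\<close> of a partially ordered type, with the induced order.  The product of
  two posets is \<open>P \<times> Q\<close>, ordered componentwise by \<open>HOL-Library.Product_Order\<close>.
\<close>

definition covers_in :: "'a::order set \<Rightarrow> 'a \<Rightarrow> 'a \<Rightarrow> bool" where
  "covers_in P x y \<longleftrightarrow> x \<in> P \<and> y \<in> P \<and> x < y \<and> \<not> (\<exists>z\<in>P. x < z \<and> z < y)"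

definition ranked_poset :: "'a::order set \<Rightarrow> bool" where
  "ranked_poset P \<longleftrightarrow>
     finite P \<and>
     (\<exists>z\<in>P. \<forall>x\<in>P. z \<le> x) \<and>
     (\<exists>u\<in>P. \<forall>x\<in>P. x \<le> u) \<and>
     (\<forall>C D. pred_on.maxchain P (<) C \<longrightarrow> pred_on.maxchain P (<) D \<longrightarrow> card C = card D)"

definition poset_bot :: "'a::order set \<Rightarrow> 'a" where
  "poset_bot P = (LEAST x. x \<in> P)"

definition poset_top :: "'a::order set \<Rightarrow> 'a" where
  "poset_top P = (GREATEST x. x \<in> P)"

text \<open>The value \<open>0\<close> outside \<open>P\<close> is a convention that makes the rank function unique.\<close>

definition is_rank_function :: "'a::order set \<Rightarrow> ('a \<Rightarrow> nat) \<Rightarrow> bool" where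
  "is_rank_function P r \<longleftrightarrow>
     r (poset_bot P) = 0 \<and>
     (\<forall>x y. covers_in P x y \<longrightarrow> r y = r x + 1) \<and>
     (\<forall>x. x \<notin> P \<longrightarrow> r x = 0)"

definition elem_rank :: "'a::order set \<Rightarrow> 'a \<Rightarrow> nat" where
  "elem_rank P = (THE r. is_rank_function P r)"

definition poset_rank :: "'a::order set \<Rightarrow> nat" where
  "poset_rank P = elem_rank P (poset_top P)"

definition rank_sum :: "'a::order set \<Rightarrow> nat" where
  "rank_sum P = (\<Sum>x\<in>P. elem_rank P x)"

definition chain_poset :: "nat \<Rightarrow> nat set" where
  "chain_poset n = {0..n}"

text \<open>
  Quilts are maps with domain \<open>P \<times> Q\<close>: as usual with \<open>\<rightarrow>\<^sub>E\<close>, they are fixed to \<open>undefined\<close>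
  outside of it, so that two quilts are equal iff they agree on \<open>P \<times> Q\<close>.
\<close>

definition Quilts :: "'a::order set \<Rightarrow> 'b::order set \<Rightarrow> ('a \<times> 'b \<Rightarrow> nat) set" where
  "Quilts P Q = {f \<in> P \<times> Q \<rightarrow>\<^sub>E UNIV.
     (\<forall>x\<in>P. \<forall>y\<in>Q. x = poset_bot P \<or> y = poset_bot Q \<longrightarrow> f (x, y) = 0) \<and>
     f (poset_top P, poset_top Q) = min (poset_rank P) (poset_rank Q) \<and>
     (\<forall>a b. covers_in (P \<times> Q) a b \<longrightarrow> f b \<in> {f a, f a + 1})}"

definition jumps :: "'a::order set \<Rightarrow> ('a \<times> nat \<Rightarrow> nat) \<Rightarrow> nat set" where
  "jumps P f = {i \<in> {1..rank_sum P}. \<exists>x\<in>P. f (x, i) = f (x, i - 1) + 1}"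

definition standard_quilts :: "'a::order set \<Rightarrow> ('a \<times> nat \<Rightarrow> nat) set" where
  "standard_quilts P =
     {f \<in> Quilts P (chain_poset (rank_sum P)). jumps P f = {1..rank_sum P}}"


subsection \<open>Well-definedness of the least and greatest element and of the rank function\<close>

lemma poset_bot:
  assumes "ranked_poset P"
  shows "poset_bot P \<in> P" "x \<in> P \<Longrightarrow> poset_bot P \<le> x"
proof -
  obtain z where z: "z \<in> P" "\<forall>x\<in>P. z \<le> x" using assms by (auto simp: ranked_poset_def)
  then have "poset_bot P = z"
    unfolding poset_bot_def by (intro Least_equality) auto
  with z show "poset_bot P \<in> P" "x \<in> P \<Longrightarrow> poset_bot P \<le> x" by auto
qed

lemma poset_top:
  assumes "ranked_poset P"
  shows "poset_top P \<in> P" "x \<in> P \<Longrightarrow> x \<le> poset_top P"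
proof -
  obtain u where u: "u \<in> P" "\<forall>x\<in>P. x \<le> u" using assms by (auto simp: ranked_poset_def)
  then have "poset_top P = u"
    unfolding poset_top_def by (intro Greatest_equality) auto
  with u show "poset_top P \<in> P" "x \<in> P \<Longrightarrow> x \<le> poset_top P" by auto
qed

lemma ex_lower_cover:
  assumes "ranked_poset P" "y \<in> P" "y \<noteq> poset_bot P"
  shows "\<exists>x. covers_in P x y"
proof -
  let ?S = "{x \<in> P. x < y}"
  have "finite ?S" using assms by (simp add: ranked_poset_def)
  moreover have "poset_bot P \<in> ?S"
    using poset_bot[OF assms(1)] assms by (auto simp: less_le)
  ultimately obtain x where "x \<in> ?S" "\<forall>z\<in>?S. x \<le> z \<longrightarrow> x = z"
    using finite_has_maximal[of ?S] by (metis (no_types, lifting) empty_iff)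
  then have "covers_in P x y" using assms(2) by (force simp: covers_in_def)
  then show ?thesis ..
qed

lemma rank_function_unique:
  assumes P: "ranked_poset P" and r: "is_rank_function P r" and s: "is_rank_function P s"
  shows "r = s"
proof
  fix y
  have fin: "finite P" using P by (simp add: ranked_poset_def)
  have "y \<in> P \<Longrightarrow> r y = s y"
  proof (induction "card {x \<in> P. x < y}" arbitrary: y rule: less_induct)
    case less
    show ?case
    proof (cases "y = poset_bot P")
      case True
      then show ?thesis using r s by (simp add: is_rank_function_def)
    next
      case False
      then obtain x where x: "covers_in P x y" using ex_lower_cover[OF P less.prems] by blast
      then have "{z \<in> P. z < x} \<subset> {z \<in> P. z < y}"
        by (auto simp: covers_in_def)
      then have "r x = s x"
        using less.hyps[of x] x fin by (simp add: psubset_card_mono covers_in_def)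
      then show ?thesis using r s x by (simp add: is_rank_function_def)
    qed
  qed
  then show "r y = s y" using r s by (cases "y \<in> P") (auto simp: is_rank_function_def)
qed

lemma rank_function_exists:
  fixes P :: "'a::order set"
  assumes P: "ranked_poset P"
  shows "\<exists>r. is_rank_function P r"
proof -
  define chn where "chn = (\<lambda>A C. pred_on.chain A (<) (C::'a set))"
  define dn where "dn = (\<lambda>y. {x \<in> P. x < y})"
  define up where "up = (\<lambda>y. {x \<in> P. y < x})"
  have chn: "chn A C \<longleftrightarrow> C \<subseteq> A \<and> (\<forall>x\<in>C. \<forall>y\<in>C. x \<le> y \<or> y \<le> x)" for A C
    unfolding chn_def pred_on.chain_def by (auto simp: less_le)
  define h where "h = (\<lambda>y. if y \<in> P then Max (card ` {C. chn (dn y) C}) else 0)"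
  have fin: "finite P" using P by (simp add: ranked_poset_def)
  have finc: "finite {C. chn (S y) C}" if "S = dn \<or> S = up" for y S
    by (rule finite_subset[of _ "Pow P"]) (use that fin in \<open>auto simp: chn dn_def up_def\<close>)
  have ex: "\<exists>C. chn (S y) C \<and> (\<forall>D. chn (S y) D \<longrightarrow> card D \<le> card C)
              \<and> card C = Max (card ` {C. chn (S y) C})"
    if S: "S = dn \<or> S = up" for y S
  proof -
    have ne: "card ` {C. chn (S y) C} \<noteq> {}" by (auto simp: chn)
    have "Max (card ` {C. chn (S y) C}) \<in> card ` {C. chn (S y) C}"
      by (intro Max_in finite_imageI finc S ne)
    then obtain C where "chn (S y) C" "card C = Max (card ` {C. chn (S y) C})" by auto
    moreover have "card D \<le> Max (card ` {C. chn (S y) C})" if "chn (S y) D" for D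
      by (intro Max_ge finite_imageI finc S) (use that in auto)
    ultimately show ?thesis by metis
  qed
  have un: "chn A (X \<union> Y)"
    if "chn S X" "chn T Y" "X \<union> Y \<subseteq> A" "\<And>x y. x \<in> X \<Longrightarrow> y \<in> Y \<Longrightarrow> x < y" for A S T X Y
    using that unfolding chn by (metis Un_iff less_imp_le)
  have ins: "chn A (insert s C)"
    if "chn B C" "C \<subseteq> A" "s \<in> A" "chn P S" "insert s C \<subseteq> S" for A B C S s
    using that unfolding chn by (metis insert_iff insert_subset subset_eq)
  have sg: "chn {y} {y}" for y by (simp add: chn)
  have dnD: "x < y" "x \<in> P" if "chn (dn y) C" "x \<in> C" for x y C
    using that by (auto simp: chn dn_def)
  have upD: "y < x" "x \<in> P" if "chn (up y) C" "x \<in> C" for x y C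
    using that by (auto simp: chn up_def)
  have mx: "pred_on.maxchain P (<) (C \<union> {y} \<union> E)"
    if y: "y \<in> P" and C: "chn (dn y) C" "\<forall>D. chn (dn y) D \<longrightarrow> card D \<le> card C"
      and E: "chn (up y) E" "\<forall>D. chn (up y) D \<longrightarrow> card D \<le> card E" for y C E
  proof -
    have c: "chn P (C \<union> {y} \<union> E)"
    proof (rule un[OF un[OF C(1) sg] E(1)])
      show "C \<union> {y} \<subseteq> C \<union> {y}" ..
      show "C \<union> {y} \<union> E \<subseteq> P" using y dnD(2)[OF C(1)] upD(2)[OF E(1)] by auto
      show "v < w" if "v \<in> C" "w \<in> {y}" for v w using that dnD[OF C(1)] by auto
      show "v < w" if "v \<in> C \<union> {y}" "w \<in> E" for v w
        using that dnD(1)[OF C(1)] upD(1)[OF E(1)] less_trans by blast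
    qed
    have "\<not> C \<union> {y} \<union> E \<subset> S" if S: "chn P S" for S
    proof
      assume sub: "C \<union> {y} \<union> E \<subset> S"
      then obtain s where s: "s \<in> S" "s \<notin> C" "s \<noteq> y" "s \<notin> E" by auto
      have sP: "s \<in> P" using s S by (auto simp: chn)
      have finCE: "finite C" "finite E"
        using C(1) E(1) fin by (auto simp: chn dn_def up_def intro: finite_subset)
      have "s < y \<or> y < s" using s S sub by (auto simp: chn less_le)
      then show False
      proof
        assume "s < y"
        then have "chn (dn y) (insert s C)"
          using s sP sub dnD[OF C(1)]
            by (intro ins[OF C(1) _ _ S]) (auto simp: dn_def)
        then show False using C(2) s finCE by fastforce
      next
        assume "y < s"
        then have "chn (up y) (insert s E)"
          using s sP sub upD[OF E(1)]
            by (intro ins[OF E(1) _ _ S]) (auto simp: up_def)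
        then show False using E(2) s finCE by fastforce
      qed
    qed
    then show ?thesis using c unfolding pred_on.maxchain_def chn_def by blast
  qed
  have "h (poset_bot P) = 0"
  proof -
    have "dn (poset_bot P) = {}"
      using poset_bot(2)[OF P] leD by (fastforce simp: dn_def)
    then have "{C. chn (dn (poset_bot P)) C} = {{}}" by (auto simp: chn)
    then show ?thesis by (simp add: h_def)
  qed
  moreover have "h y = h x + 1" if cov: "covers_in P x y" for x y
  proof -
    have xy: "x \<in> P" "y \<in> P" "x < y" and nb: "\<And>z. z \<in> P \<Longrightarrow> x < z \<Longrightarrow> z < y \<Longrightarrow> False"
      using cov by (auto simp: covers_in_def)
    obtain C where C: "chn (dn x) C" "\<forall>D. chn (dn x) D \<longrightarrow> card D \<le> card C" "card C = h x"
      using ex[of dn x] xy by (auto simp: h_def)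
    obtain D where D: "chn (dn y) D" "\<forall>E. chn (dn y) E \<longrightarrow> card E \<le> card D" "card D = h y"
      using ex[of dn y] xy by (auto simp: h_def)
    obtain E where E: "chn (up y) E" "\<forall>D. chn (up y) D \<longrightarrow> card D \<le> card E"
      using ex[of up y] by auto
    have finCDE: "finite C" "finite D" "finite E"
      using C(1) D(1) E(1) fin by (auto simp: chn dn_def up_def intro: finite_subset)
    have ye: "y \<notin> E" "x \<notin> E" "x \<notin> C" "y \<notin> C" "y \<notin> D" "D \<inter> E = {}" "C \<inter> E = {}"
      using dnD(1)[OF C(1)] dnD(1)[OF D(1)] upD(1)[OF E(1)] xy
      by (meson disjoint_iff less_asym less_irrefl less_trans)+
    have m1: "pred_on.maxchain P (<) (D \<union> {y} \<union> E)" by (rule mx[OF xy(2) D(1,2) E])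
    have yE: "chn (up x) ({y} \<union> E)"
      by (rule un[OF sg E(1)]) (use xy upD[OF E(1)] in \<open>auto simp: up_def intro: less_trans\<close>)
    have c0: "chn P (C \<union> {x} \<union> ({y} \<union> E))"
    proof (rule un[OF un[OF C(1) sg] yE])
      show "C \<union> {x} \<subseteq> C \<union> {x}" ..
      show "C \<union> {x} \<union> ({y} \<union> E) \<subseteq> P" using xy dnD(2)[OF C(1)] upD(2)[OF E(1)] by auto
      show "v < w" if "v \<in> C" "w \<in> {x}" for v w using that dnD[OF C(1)] by auto
      show "v < w" if "v \<in> C \<union> {x}" "w \<in> {y} \<union> E" for v w
        using that dnD(1)[OF C(1)] upD(1)[OF yE] less_trans by blast
    qed
    have m2: "pred_on.maxchain P (<) (C \<union> {x} \<union> ({y} \<union> E))"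
    proof -
      have "\<not> C \<union> {x} \<union> ({y} \<union> E) \<subset> S" if S: "chn P S" for S
      proof
        assume sub: "C \<union> {x} \<union> ({y} \<union> E) \<subset> S"
        then obtain s where s: "s \<in> S" "s \<notin> C" "s \<noteq> x" "s \<noteq> y" "s \<notin> E" by auto
        have sP: "s \<in> P" using s S by (auto simp: chn)
        have "s < x \<or> x < s" "s < y \<or> y < s" using s S sub by (auto simp: chn less_le)
        then consider "s < x" | "y < s" using nb[OF sP] by auto
        then show False
        proof cases
          case 1
          then have "chn (dn x) (insert s C)"
            using s sP sub dnD[OF C(1)]
            by (intro ins[OF C(1) _ _ S]) (auto simp: dn_def)
          then show False using C(2) s finCDE by fastforce
        next
          case 2
          then have "chn (up y) (insert s E)"
            using s sP sub upD[OF E(1)]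
            by (intro ins[OF E(1) _ _ S]) (auto simp: up_def)
          then show False using E(2) s finCDE by fastforce
        qed
      qed
      then show ?thesis using c0 unfolding pred_on.maxchain_def chn_def by blast
    qed
    have "card (D \<union> {y} \<union> E) = card (C \<union> {x} \<union> ({y} \<union> E))"
      using P m1 m2 unfolding ranked_poset_def by blast
    moreover have "card (D \<union> {y} \<union> E) = card D + 1 + card E"
      using finCDE ye by (subst card_Un_disjoint; auto)+
    moreover have "card (C \<union> {x} \<union> ({y} \<union> E)) = (card C + 1) + (1 + card E)"
      using finCDE ye xy by (subst card_Un_disjoint; auto)+
    ultimately show ?thesis using C(3) D(3) by simp
  qed
  ultimately have "is_rank_function P h"
    by (auto simp: is_rank_function_def h_def)
  then show ?thesis by blast
qed

lemma is_rank_function_elem_rank: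
  assumes "ranked_poset P"
  shows "is_rank_function P (elem_rank P)"
  unfolding elem_rank_def
  using rank_function_exists[OF assms] rank_function_unique[OF assms] by (metis theI')

end

theory Submission
  imports Defs
begin

text \<open>
  Read a quilt of type \<open>(P, C\<^sub>n)\<close> column by column: it is a walk with \<open>n\<close> steps in the digraph whose
  vertices are the maps \<open>P \<rightarrow> \<nat>\<close> with value \<open>0\<close> at the bottom and increments in \<open>{0, 1}\<close> along
  covers, and whose edges raise some of the values by \<open>1\<close>.  For \<open>n \<ge> rank P\<close> the walk leads from
  the zero map to the rank function, the only vertex whose value at the top is \<open>rank P\<close>.  Its
  jumps are the steps that are not loops, so choosing their positions shows that the number of
  quilts is \<open>\<Sum>k. (n choose k) s\<^sub>k\<close>, with \<open>s\<^sub>k\<close> the number of loopless walks of length \<open>k\<close>.  Every such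
  step raises the sum of the values, whence \<open>s\<^sub>k = 0\<close> for \<open>k > b(P)\<close>, and \<open>s\<^sub>k = |S(P)|\<close> for
  \<open>k = b(P)\<close>.  This number is positive, since the values can be raised one at a time.
\<close>

section \<open>Walks in a digraph\<close>

text \<open>A walk with \<open>n\<close> steps is encoded by its \<open>n + 1\<close>
  vertices.\<close>

definition walks :: "('v \<Rightarrow> 'v \<Rightarrow> bool) \<Rightarrow> nat \<Rightarrow> 'v \<Rightarrow> 'v \<Rightarrow> 'v list set" where
  "walks R n s t = {ws. length ws = Suc n \<and> hd ws = s \<and> last ws = t \<and> successively R ws}"

lemma walks_0: "walks R 0 s t = (if s = t then {[s]} else {})"
  by (auto simp: walks_def length_Suc_conv)

lemma walks_Suc: "walks R (Suc n) s t = (#) s ` (\<Union>h\<in>{h. R s h}. walks R n h t)"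
proof (intro set_eqI iffI)
  fix ws assume "ws \<in> walks R (Suc n) s t"
  then obtain h vs where "ws = s # h # vs" "R s h" "h # vs \<in> walks R n h t"
    by (auto simp: walks_def length_Suc_conv)
  then show "ws \<in> (#) s ` (\<Union>h\<in>{h. R s h}. walks R n h t)" by blast
next
  fix ws assume "ws \<in> (#) s ` (\<Union>h\<in>{h. R s h}. walks R n h t)"
  then show "ws \<in> walks R (Suc n) s t"
    by (auto simp: walks_def successively_Cons)
qed

lemma finite_walks:
  assumes "\<And>s. finite {h. R s h}"
  shows "finite (walks R n s t)"
  by (induction n arbitrary: s) (auto simp: walks_0 walks_Suc assms)

lemma card_walks_Suc:
  assumes "\<And>s. finite {h. R s h}"
  shows "card (walks R (Suc n) s t) = (\<Sum>h | R s h. card (walks R n h t))"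
proof -
  have "card (walks R (Suc n) s t) = card (\<Union>h\<in>{h. R s h}. walks R n h t)"
    unfolding walks_Suc by (simp add: card_image)
  also have "\<dots> = (\<Sum>h | R s h. card (walks R n h t))"
    \<comment> \<open>Walks starting at different \<open>h\<close> differ in their heads, so the
      union is disjoint.\<close>
    by (rule card_UN_disjoint) (auto simp: assms finite_walks, auto simp: walks_def)
  finally show ?thesis .
qed

text \<open>Deleting the loops from a walk leaves a loopless walk of some length \<open>k\<close>,
  and the positions of its \<open>k\<close> steps among the \<open>n\<close> are arbitrary because
  every vertex reached carries a loop. The induction splits on whether the first step is the loop at
  \<open>s\<close>.\<close>

lemma card_walks_eq_sum_loopless:
  assumes fin: "\<And>s. finite {h. R s h}" and refl: "\<And>s h. R s h \<Longrightarrow> R h h" and "R s s"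
  defines "L \<equiv> \<lambda>a b. R a b \<and> a \<noteq> b"
  shows "card (walks R n s t) = (\<Sum>k\<le>n. (n choose k) * card (walks L k s t))"
  using \<open>R s s\<close>
proof (induction n arbitrary: s)
  case 0
  then show ?case by (simp add: walks_0)
next
  case (Suc n)
  have finL: "finite {h. L s h}" for s
    using fin by (rule rev_finite_subset) (auto simp: L_def)
  have split: "{h. R s h} = insert s {h. L s h}" "s \<notin> {h. L s h}"
    using Suc.prems by (auto simp: L_def)
  let ?c = "\<lambda>k. card (walks L k s t)"
  have "card (walks R (Suc n) s t)
      = card (walks R n s t) + (\<Sum>h | L s h. card (walks R n h t))"
    unfolding card_walks_Suc[OF fin] split(1) using split(2) finL by simp
  also have "(\<Sum>h | L s h. card (walks R n h t))
      = (\<Sum>h | L s h. \<Sum>k\<le>n. (n choose k) * card (walks L k h t))"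
    by (rule sum.cong[OF HOL.refl Suc.IH]) (use refl in \<open>auto simp: L_def\<close>)
  also have "\<dots> = (\<Sum>k\<le>n. (n choose k) * ?c (Suc k))"
    unfolding card_walks_Suc[OF finL] by (subst sum.swap) (simp add: sum_distrib_left)
  \<comment> \<open>The added term \<open>k = Suc n\<close> vanishes. After an index shift, both
    sums run over \<open>?c (Suc k)\<close> and Pascal's rule merges them.\<close>
  also have "card (walks R n s t) = (\<Sum>k\<le>Suc n. (n choose k) * ?c k)"
    using Suc by simp
  also have "\<dots> = ?c 0 + (\<Sum>k\<le>n. (n choose Suc k) * ?c (Suc k))"
    by (subst sum.atMost_Suc_shift) simp
  also have "\<dots> + (\<Sum>k\<le>n. (n choose k) * ?c (Suc k))
      = ?c 0 + (\<Sum>k\<le>n. (Suc n choose Suc k) * ?c (Suc k))"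
    by (simp add: sum.distrib algebra_simps)
  also have "\<dots> = (\<Sum>k\<le>Suc n. (Suc n choose k) * ?c k)"
    unfolding sum.atMost_Suc_shift by simp
  finally show ?case .
qed

text \<open>\<open>D\<close> is a potential in the naturals that drops at every step.\<close>

lemma walk_length_le:
  assumes "\<And>a b. R a b \<Longrightarrow> D b < (D a :: nat)" "walks R n s t \<noteq> {}"
  shows "n \<le> D s"
  using assms(2)
proof (induction n arbitrary: s)
  case (Suc n)
  then obtain h where "R s h" "walks R n h t \<noteq> {}" by (auto simp: walks_Suc)
  with Suc.IH assms(1) show ?case by fastforce
qed simp


section \<open>Binomial coefficients as polynomials\<close>

text \<open>The falling factorial X(X-1)...(X-k+1) divided by k!.\<close>

definition binom_poly :: "nat \<Rightarrow> 'a::field_char_0 poly" where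
  "binom_poly k = smult (inverse (fact k)) (\<Prod>i<k. [:- of_nat i, 1:])"

lemma poly_binom_poly: "poly (binom_poly k) (of_nat n) = of_nat (n choose k)"
  by (simp add: binom_poly_def poly_prod binomial_gbinomial gbinomial_prod_rev
      atLeast0LessThan divide_inverse)

lemma degree_prod_linear: "degree (\<Prod>i<k. [:- of_nat i, 1 :: 'a::field_char_0:]) = k"
  by (subst degree_prod_eq_sum_degree) auto

lemma degree_binom_poly: "degree (binom_poly k :: 'a::field_char_0 poly) = k"
  by (simp add: binom_poly_def degree_prod_linear)

lemma coeff_binom_poly: "coeff (binom_poly k :: 'a::field_char_0 poly) k = 1 / fact k"
proof -
  have "lead_coeff (\<Prod>i<k. [:- of_nat i, 1 :: 'a:]) = 1"
    by (simp add: lead_coeff_prod)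
  then show ?thesis by (simp add: binom_poly_def degree_prod_linear divide_inverse)
qed

text \<open>Only the term \<open>k = b\<close> reaches degree \<open>b\<close>, with leading
  coefficient 1/b!; positivity of \<open>s b\<close> keeps it from vanishing.\<close>

lemma binomial_sum_polynomial:
  fixes s :: "nat \<Rightarrow> nat"
  assumes zero: "\<And>k. k > b \<Longrightarrow> s k = 0" and pos: "s b > 0"
  shows "\<exists>p :: 'a::field_char_0 poly. degree p = b \<and>
    (\<forall>n. of_nat (\<Sum>k\<le>n. (n choose k) * s k) = poly p (of_nat n)) \<and>
    lead_coeff p = of_nat (s b) / fact b"
proof -
  define p :: "'a poly" where "p = (\<Sum>k\<le>b. smult (of_nat (s k)) (binom_poly k))"
  have "coeff p b = (\<Sum>k\<le>b. if k = b then of_nat (s b) / fact b else 0)"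
    unfolding p_def coeff_sum
    by (intro sum.cong refl) (auto simp: coeff_binom_poly coeff_eq_0 degree_binom_poly)
  then have lc: "coeff p b = of_nat (s b) / fact b" by simp
  have "degree p \<le> b"
    unfolding p_def by (rule degree_sum_le) (auto simp: degree_binom_poly)
  moreover have "degree p \<ge> b" using lc pos by (intro le_degree) simp
  ultimately have deg: "degree p = b" by simp
  have "of_nat (\<Sum>k\<le>n. (n choose k) * s k) = poly p (of_nat n)" for n
  proof -
    \<comment> \<open>The terms with \<open>k > n\<close> vanish through the binomial, those with
      \<open>k > b\<close> through \<open>s\<close>, so both ranges can be compared with
      \<open>max n b\<close>.\<close>
    have "(\<Sum>k\<le>n. (n choose k) * s k) = (\<Sum>k\<le>max n b. (n choose k) * s k)"
      by (rule sum.mono_neutral_left) auto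
    also have "\<dots> = (\<Sum>k\<le>b. (n choose k) * s k)"
      by (rule sum.mono_neutral_right) (auto simp: zero)
    finally show ?thesis
      by (simp add: p_def poly_sum poly_binom_poly mult.commute)
  qed
  with deg lc show ?thesis by blast
qed


section \<open>Covers\<close>

text \<open>A maximal element of the interval [x, y) is covered by \<open>y\<close> and has fewer
  elements below it, so one can descend to \<open>x\<close>.\<close>

lemma covers_in_rtranclp:
  assumes fin: "finite P" and xy: "x \<in> P" "y \<in> P" "x \<le> y"
  shows "(covers_in P)\<^sup>*\<^sup>* x y"
  using xy(2,3)
proof (induction "card {z \<in> P. z < y}" arbitrary: y rule: less_induct)
  case less
  show ?case
  proof (cases "x = y")
    case False
    let ?S = "{z \<in> P. x \<le> z \<and> z < y}"
    have "finite ?S" "x \<in> ?S" using fin xy(1) less.prems False by auto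
    then obtain z where z: "z \<in> ?S" "\<forall>w\<in>?S. z \<le> w \<longrightarrow> z = w"
      using finite_has_maximal[of ?S] by (metis (no_types, lifting) empty_iff)
    then have cov: "covers_in P z y" using less.prems by (force simp: covers_in_def)
    have "{w \<in> P. w < z} \<subset> {w \<in> P. w < y}" using z(1) by auto
    then have "card {w \<in> P. w < z} < card {w \<in> P. w < y}"
      using fin by (simp add: psubset_card_mono)
    then have "(covers_in P)\<^sup>*\<^sup>* x z" using less.hyps z(1) by blast
    with cov show ?thesis by simp
  qed simp
qed

lemma covers_in_prod_chain:
  "covers_in (P \<times> chain_poset n) (x, i) (y, j) \<longleftrightarrow>
    covers_in P x y \<and> i = j \<and> i \<le> n \<or> x \<in> P \<and> x = y \<and> j = Suc i \<and> j \<le> n"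
  (is "?L \<longleftrightarrow> ?R")
proof
  assume ?L
  then have m: "x \<in> P" "y \<in> P" "i \<le> n" "j \<le> n" and lt: "(x, i) < (y, j)"
    and nb: "\<And>z k. z \<in> P \<Longrightarrow> k \<le> n \<Longrightarrow> (x, i) < (z, k) \<Longrightarrow> (z, k) < (y, j) \<Longrightarrow> False"
    unfolding covers_in_def chain_poset_def by auto
  have less: "(u, k) < (v, l) \<longleftrightarrow> u \<le> v \<and> k \<le> l \<and> (u \<noteq> v \<or> k \<noteq> l)" for u v :: 'a and k l :: nat
    by (simp add: less_le)
  have le: "x \<le> y" "i \<le> j" "x \<noteq> y \<or> i \<noteq> j" using lt less by blast+
  \<comment> \<open>Otherwise \<open>(x, j)\<close> would lie strictly between the two
    pairs.\<close>
  have "x = y \<or> i = j"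
    using nb[of x j] m le less by blast
  then show ?R
  proof
    assume xy: "x = y"
    then have "i < j" using le by simp
    moreover have "\<not> Suc i < j" using nb[of x "Suc i"] m xy less by force
    ultimately show ?R using xy m by simp
  next
    assume ij: "i = j"
    then have "x < y" using le by simp
    moreover have "\<not> (x < z \<and> z < y)" if "z \<in> P" for z
      using nb[of z i] that m ij less by fastforce
    ultimately show ?R using ij m by (auto simp: covers_in_def)
  qed
next
  assume ?R
  then show ?L
  proof (elim disjE conjE)
    assume c: "covers_in P x y" and ij: "i = j" "i \<le> n"
    have "\<not> ((x, i) < (z, k) \<and> (z, k) < (y, i))" if "z \<in> P" for z k
    proof
      assume z: "(x, i) < (z, k) \<and> (z, k) < (y, i)"
      then have "k = i" by (auto simp: less_le)
      with z have "x < z" "z < y" by (auto simp: less_le)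
      with c that show False by (auto simp: covers_in_def)
    qed
    moreover have "(x, i) < (y, i)" using c by (auto simp: covers_in_def less_le)
    ultimately show ?L using c ij by (auto simp: covers_in_def chain_poset_def)
  next
    assume xy: "x \<in> P" "x = y" and ij: "j = Suc i" "j \<le> n"
    have "\<not> ((x, i) < (z, k) \<and> (z, k) < (x, Suc i))" for z k
    proof
      assume z: "(x, i) < (z, k) \<and> (z, k) < (x, Suc i)"
      then have "z = x" by (auto simp: less_le)
      with z show False by (auto simp: less_le)
    qed
    moreover have "(x, i) < (x, Suc i)" by (simp add: less_le)
    ultimately show ?L using xy ij by (auto simp: covers_in_def chain_poset_def)
  qed
qed


section \<open>Ranks\<close>

lemma ranked_poset_chain: "ranked_poset (chain_poset n)"
proof -
  have "C = chain_poset n" if "pred_on.maxchain (chain_poset n) (<) C" for C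
    using that by (auto simp: pred_on.maxchain_def pred_on.chain_def)
  then show ?thesis by (auto simp: ranked_poset_def chain_poset_def)
qed

lemma poset_bot_chain: "poset_bot (chain_poset n) = 0"
  using poset_bot(2)[OF ranked_poset_chain, of 0 n] by (simp add: chain_poset_def)

lemma poset_top_chain: "poset_top (chain_poset n) = n"
  using poset_top[OF ranked_poset_chain[of n]] by (force simp: chain_poset_def)

lemma poset_rank_chain: "poset_rank (chain_poset n) = n"
proof -
  have "y = Suc x" if "covers_in (chain_poset n) x y" for x y
  proof (rule ccontr)
    assume "y \<noteq> Suc x"
    with that have "Suc x \<in> chain_poset n" "x < Suc x" "Suc x < y"
      by (auto simp: covers_in_def chain_poset_def)
    with that show False unfolding covers_in_def by blast
  qed
  \<comment> \<open>The value 0 beyond \<open>n\<close> is the convention under which rank functions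
    are unique.\<close>
  then have "is_rank_function (chain_poset n) (\<lambda>i. if i \<le> n then i else 0)"
    unfolding is_rank_function_def poset_bot_chain
    by (simp add: chain_poset_def) (simp add: covers_in_def)
  then have "elem_rank (chain_poset n) = (\<lambda>i. if i \<le> n then i else 0)"
    using is_rank_function_elem_rank rank_function_unique ranked_poset_chain by blast
  then show ?thesis by (simp add: poset_rank_def poset_top_chain)
qed

lemma elem_rank_bot:
  assumes "ranked_poset P"
  shows "elem_rank P (poset_bot P) = 0"
  using is_rank_function_elem_rank[OF assms] by (simp add: is_rank_function_def)

lemma elem_rank_covers:
  assumes "ranked_poset P" "covers_in P x y"
  shows "elem_rank P y = Suc (elem_rank P x)"
  using is_rank_function_elem_rank[OF assms(1)] assms(2) by (simp add: is_rank_function_def)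

text \<open>The rank of the top is one of the summands. Hence the description of quilts for
  \<open>n >= poset_rank P\<close> also applies at \<open>n = rank_sum P\<close>, where standard
  quilts live.\<close>

lemma poset_rank_le_rank_sum:
  assumes "ranked_poset P"
  shows "poset_rank P \<le> rank_sum P"
  unfolding poset_rank_def rank_sum_def
  using assms poset_top(1)[OF assms] by (intro member_le_sum) (auto simp: ranked_poset_def)


section \<open>Layers of quilts\<close>

text \<open>The candidates for a column of a quilt, extensional so that agreement on
  \<open>P\<close> is equality.\<close>

definition layers :: "'a::order set \<Rightarrow> ('a \<Rightarrow> nat) set" where
  "layers P = {g \<in> P \<rightarrow>\<^sub>E UNIV. g (poset_bot P) = 0 \<and>
     (\<forall>x y. covers_in P x y \<longrightarrow> g y \<in> {g x, g x + 1})}"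

definition layer_step :: "'a::order set \<Rightarrow> ('a \<Rightarrow> nat) \<Rightarrow> ('a \<Rightarrow> nat) \<Rightarrow> bool" where
  "layer_step P g h \<longleftrightarrow> g \<in> layers P \<and> h \<in> layers P \<and> (\<forall>x\<in>P. h x \<in> {g x, g x + 1})"

definition zero_layer :: "'a::order set \<Rightarrow> 'a \<Rightarrow> nat" where
  "zero_layer P = restrict (\<lambda>_. 0) P"

definition rank_layer :: "'a::order set \<Rightarrow> 'a \<Rightarrow> nat" where
  "rank_layer P = restrict (elem_rank P) P"

text \<open>The number of unit raises separating a layer from the rank function; the truncated
  subtraction loses nothing by \<open>layer_le_rank\<close>.\<close>

definition deficit :: "'a::order set \<Rightarrow> ('a \<Rightarrow> nat) \<Rightarrow> nat" where
  "deficit P g = (\<Sum>x\<in>P. elem_rank P x - g x)"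

context
  fixes P :: "'a::order set"
  assumes P: "ranked_poset P"
begin

lemma finite_P: "finite P"
  using P by (simp add: ranked_poset_def)

lemma zero_layer: "zero_layer P \<in> layers P"
  using poset_bot(1)[OF P] by (auto simp: zero_layer_def layers_def covers_in_def)

text \<open>Along a saturated chain from \<open>x\<close> to \<open>y\<close>, each cover adds 1 to
  the rank and at most 1 to \<open>g\<close>. The additive form avoids truncated
  subtraction.\<close>

lemma layer_growth_le:
  assumes g: "g \<in> layers P" and xy: "x \<in> P" "y \<in> P" "x \<le> y"
  shows "g y + elem_rank P x \<le> g x + elem_rank P y"
  using covers_in_rtranclp[OF finite_P xy]
proof induction
  case (step y z)
  then have "g z \<in> {g y, g y + 1}" using g by (simp add: layers_def)
  with step elem_rank_covers[OF P step.hyps(2)] show ?case by auto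
qed simp

lemma layer_le_rank:
  assumes "g \<in> layers P" "x \<in> P"
  shows "g x \<le> elem_rank P x"
  using layer_growth_le[OF assms(1) poset_bot(1)[OF P] assms(2) poset_bot(2)[OF P assms(2)]]
    elem_rank_bot[OF P] assms(1) by (simp add: layers_def)

text \<open>If \<open>g\<close> has full rank at the top, its bounded growth from \<open>x\<close>
  to the top forces \<open>g x\<close> to be at least the rank of \<open>x\<close>.\<close>

lemma layer_top_eq_rank_iff:
  assumes g: "g \<in> layers P"
  shows "g (poset_top P) = poset_rank P \<longleftrightarrow> g = rank_layer P"
proof
  assume top: "g (poset_top P) = poset_rank P"
  have "g x = elem_rank P x" if x: "x \<in> P" for x
    using layer_growth_le[OF g x poset_top(1)[OF P] poset_top(2)[OF P x]]
      layer_le_rank[OF g x] top by (simp add: poset_rank_def)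
  then show "g = rank_layer P"
    using g by (auto simp: rank_layer_def layers_def PiE_def extensional_def)
qed (simp add: rank_layer_def poset_rank_def poset_top(1)[OF P])

lemma finite_layers: "finite (layers P)"
proof (rule finite_subset)
  show "layers P \<subseteq> Pi\<^sub>E P (\<lambda>x. {..elem_rank P x})"
  proof
    fix g assume g: "g \<in> layers P"
    then have "g \<in> extensional P" by (simp add: layers_def PiE_iff)
    with layer_le_rank[OF g] show "g \<in> Pi\<^sub>E P (\<lambda>x. {..elem_rank P x})"
      by (simp add: PiE_iff)
  qed
qed (simp add: finite_PiE finite_P)

lemma finite_layer_steps: "finite {h. layer_step P g h}"
  by (rule finite_subset[OF _ finite_layers]) (auto simp: layer_step_def)

lemma deficit_layer_step:
  assumes step: "layer_step P g h" and ne: "g \<noteq> h"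
  shows "deficit P h < deficit P g"
proof -
  have gh: "g \<in> layers P" "h \<in> layers P" "\<And>x. x \<in> P \<Longrightarrow> h x \<in> {g x, g x + 1}"
    using step by (auto simp: layer_step_def)
  then obtain x where x: "x \<in> P" "g x \<noteq> h x"
    using ne unfolding layers_def by (metis (no_types, lifting) PiE_ext mem_Collect_eq)
  show ?thesis unfolding deficit_def
  proof (rule sum_strict_mono_ex1[OF finite_P])
    show "\<forall>x\<in>P. elem_rank P x - h x \<le> elem_rank P x - g x" using gh(3) by fastforce
    \<comment> \<open>The raised value \<open>h x\<close> is still at most the rank, so truncation
      does not hide the decrease.\<close>
    show "\<exists>x\<in>P. elem_rank P x - h x < elem_rank P x - g x"
      using x gh(3)[OF x(1)] layer_le_rank[OF gh(2) x(1)] by (intro bexI[of _ x]) auto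
  qed
qed

lemma deficit_zero_layer: "deficit P (zero_layer P) = rank_sum P"
  by (simp add: deficit_def zero_layer_def rank_sum_def)

text \<open>
  Raise a value that is minimal among those below the rank, at a maximal such position: minimality
  settles the lower covers and maximality the upper covers.
\<close>

lemma ex_single_raise:
  assumes g: "g \<in> layers P" and ne: "g \<noteq> rank_layer P"
  obtains x where "x \<in> P" "g x < elem_rank P x" "g(x := g x + 1) \<in> layers P"
proof -
  let ?B = "{x \<in> P. g x < elem_rank P x}"
  have finB: "finite ?B" using finite_P by simp
  have cov: "g v \<in> {g u, g u + 1}" if "covers_in P u v" for u v
    using g that by (simp add: layers_def)
  have "?B \<noteq> {}"
  proof
    assume "?B = {}"
    then have "g (poset_top P) = poset_rank P"
      using layer_le_rank[OF g] poset_top(1)[OF P] by (force simp: poset_rank_def)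
    then show False using layer_top_eq_rank_iff[OF g] ne by blast
  qed
  then obtain a where a: "a \<in> ?B" "\<And>z. z \<in> ?B \<Longrightarrow> g a \<le> g z"
    using ex_min_if_finite[of "g ` ?B"] finB by (fastforce simp: not_less)
  let ?C = "{x \<in> ?B. g x = g a}"
  have "finite ?C" by (rule rev_finite_subset[OF finB]) auto
  moreover have "?C \<noteq> {}" using a(1) by auto
  ultimately have "\<exists>x\<in>?C. \<forall>z\<in>?C. x \<le> z \<longrightarrow> x = z" by (rule finite_has_maximal)
  then obtain x where x: "x \<in> ?C" "\<And>z. z \<in> ?C \<Longrightarrow> x \<le> z \<Longrightarrow> x = z" by blast
  \<comment> \<open>A cover \<open>v\<close> with \<open>g v = g x\<close> has larger rank, so it
    would be an element of \<open>?C\<close> above \<open>x\<close>.\<close>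
  have up: "g v = g x + 1" if c: "covers_in P x v" for v
  proof (rule ccontr)
    assume "g v \<noteq> g x + 1"
    then have "g v = g x" using cov[OF c] by simp
    then have "v \<in> ?C" using x(1) c elem_rank_covers[OF P c] by (auto simp: covers_in_def)
    with x(2)[of v] c show False by (auto simp: covers_in_def less_le)
  qed
  have down: "g u = g x" if c: "covers_in P u x" for u
  proof (rule ccontr)
    assume "g u \<noteq> g x"
    then have gx: "g x = g u + 1" using cov[OF c] by simp
    then have "u \<in> ?B" using x(1) c elem_rank_covers[OF P c] by (auto simp: covers_in_def)
    with a(2)[of u] gx x(1) show False by simp
  qed
  \<comment> \<open>The raise must keep the value 0 at the bottom.\<close>
  have "x \<noteq> poset_bot P" using x(1) elem_rank_bot[OF P] by auto
  then have "g(x := g x + 1) \<in> layers P"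
    using g x(1) up down cov by (auto simp: layers_def covers_in_def PiE_iff extensional_def)
  with that x(1) show ?thesis by blast
qed

text \<open>Single raises lower the deficit by exactly 1, so repeating them gives a loopless walk of
  the greatest possible length.\<close>

lemma ex_full_walk:
  assumes "g \<in> layers P"
  shows "walks (\<lambda>a b. layer_step P a b \<and> a \<noteq> b) (deficit P g) g (rank_layer P) \<noteq> {}"
  using assms
proof (induction "deficit P g" arbitrary: g)
  case 0
  have "g (poset_top P) = poset_rank P"
    using 0(1) layer_le_rank[OF 0(2)] poset_top(1)[OF P] finite_P
    by (force simp: deficit_def poset_rank_def intro: antisym)
  then have "g = rank_layer P" using layer_top_eq_rank_iff[OF 0(2)] by blast
  with 0 show ?case by (simp flip: 0(1) add: walks_0)
next
  case (Suc d)
  have "g \<noteq> rank_layer P"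
    using Suc(2) by (auto simp: deficit_def rank_layer_def)
  then obtain x where x: "x \<in> P" "g x < elem_rank P x" "g(x := g x + 1) \<in> layers P"
    using ex_single_raise[OF Suc.prems] by blast
  let ?h = "g(x := g x + 1)"
  have "(\<Sum>y\<in>P - {x}. elem_rank P y - ?h y) = (\<Sum>y\<in>P - {x}. elem_rank P y - g y)"
    by (rule sum.cong) auto
  then have "deficit P g = Suc (deficit P ?h)"
    unfolding deficit_def using x(1,2) by (simp add: sum.remove[OF finite_P x(1)])
  then have d: "d = deficit P ?h" using Suc(2) by simp
  have "layer_step P g ?h" "g \<noteq> ?h"
    using Suc.prems x by (auto simp: layer_step_def fun_eq_iff)
  with Suc(1)[OF d x(3)] show ?case
    unfolding Suc(2)[symmetric] walks_Suc d by blast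
qed


section \<open>Quilts as walks\<close>

definition layer_list :: "nat \<Rightarrow> ('a \<times> nat \<Rightarrow> nat) \<Rightarrow> ('a \<Rightarrow> nat) list" where
  "layer_list n f = map (\<lambda>i. \<lambda>x\<in>P. f (x, i)) [0..<Suc n]"

lemma length_layer_list: "length (layer_list n f) = Suc n"
  by (simp add: layer_list_def)

lemma nth_layer_list: "i \<le> n \<Longrightarrow> layer_list n f ! i = (\<lambda>x\<in>P. f (x, i))"
  by (simp add: layer_list_def nth_append del: upt_Suc)

text \<open>Covers of the product within one column give the layer condition, and those between
  consecutive columns give the steps. As \<open>n >= poset_rank P\<close>, the minimum in the top
  condition is the rank of \<open>P\<close>, which pins the last layer.\<close>

lemma Quilts_chain_iff:
  assumes n: "poset_rank P \<le> n"
  shows "f \<in> Quilts P (chain_poset n) \<longleftrightarrow> f \<in> P \<times> {0..n} \<rightarrow>\<^sub>E UNIV \<and>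
    layer_list n f \<in> walks (layer_step P) n (zero_layer P) (rank_layer P)"
proof -
  have bot: "poset_bot P \<in> P" and top: "poset_top P \<in> P"
    using poset_bot(1)[OF P] poset_top(1)[OF P] by auto
  let ?g = "\<lambda>i. \<lambda>x\<in>P. f (x, i)"
  have lay: "?g i \<in> layers P \<longleftrightarrow> f (poset_bot P, i) = 0 \<and>
      (\<forall>x y. covers_in P x y \<longrightarrow> f (y, i) \<in> {f (x, i), f (x, i) + 1})" for i
    using bot by (auto simp: layers_def covers_in_def)
  have zero: "?g 0 = zero_layer P \<longleftrightarrow> (\<forall>x\<in>P. f (x, 0) = 0)"
    by (auto simp: zero_layer_def fun_eq_iff)
  have "layer_list n f \<in> walks (layer_step P) n (zero_layer P) (rank_layer P) \<longleftrightarrow>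
      ?g 0 = zero_layer P \<and> ?g n = rank_layer P \<and> (\<forall>i<n. layer_step P (?g i) (?g (Suc i)))"
    by (auto simp: walks_def length_layer_list hd_conv_nth last_conv_nth nth_layer_list
        successively_conv_nth simp flip: length_greater_0_conv)
  also have "\<dots> \<longleftrightarrow> ?g 0 = zero_layer P \<and> f (poset_top P, n) = poset_rank P \<and>
      (\<forall>i\<le>n. ?g i \<in> layers P) \<and> (\<forall>i<n. \<forall>x\<in>P. f (x, Suc i) \<in> {f (x, i), f (x, i) + 1})"
    (is "?A \<longleftrightarrow> ?B")
  proof
    assume A: ?A
    \<comment> \<open>Layer 0 is treated apart, since for \<open>n = 0\<close> there is no step to
      make it a layer.\<close>
    have "?g i \<in> layers P" if "i \<le> n" for i
      using that A zero_layer by (cases i) (auto simp: layer_step_def)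
    moreover have "f (poset_top P, n) = poset_rank P"
    proof -
      have "?g n = rank_layer P" using A by simp
      from fun_cong[OF this, of "poset_top P"] show ?thesis
        using top by (simp add: rank_layer_def poset_rank_def)
    qed
    ultimately show ?B using A by (simp add: layer_step_def)
  next
    assume B: ?B
    then have "?g n = rank_layer P" using layer_top_eq_rank_iff[of "?g n"] top by simp
    with B show ?A by (simp add: layer_step_def)
  qed
  also have "f \<in> P \<times> {0..n} \<rightarrow>\<^sub>E UNIV \<and> \<dots> \<longleftrightarrow> f \<in> Quilts P (chain_poset n)"
  proof -
    have bounds: "(\<forall>x\<in>P. \<forall>y\<in>chain_poset n. x = poset_bot P \<or> y = 0 \<longrightarrow> f (x, y) = 0) \<longleftrightarrow>
        (\<forall>x\<in>P. f (x, 0) = 0) \<and> (\<forall>i\<le>n. f (poset_bot P, i) = 0)"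
      using bot by (fastforce simp: chain_poset_def)
    have steps: "(\<forall>a b. covers_in (P \<times> chain_poset n) a b \<longrightarrow> f b \<in> {f a, f a + 1}) \<longleftrightarrow>
        (\<forall>i\<le>n. \<forall>x y. covers_in P x y \<longrightarrow> f (y, i) \<in> {f (x, i), f (x, i) + 1}) \<and>
        (\<forall>i<n. \<forall>x\<in>P. f (x, Suc i) \<in> {f (x, i), f (x, i) + 1})"
      unfolding split_paired_All covers_in_prod_chain less_eq_Suc_le by blast
    show ?thesis
      unfolding Quilts_def mem_Collect_eq poset_bot_chain poset_top_chain poset_rank_chain
        min_absorb1[OF n] bounds steps zero lay
      unfolding chain_poset_def by blast
  qed
  finally show ?thesis by simp
qed

lemma bij_betw_layer_list:
  assumes n: "poset_rank P \<le> n"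
  shows "bij_betw (layer_list n) (Quilts P (chain_poset n))
    (walks (layer_step P) n (zero_layer P) (rank_layer P))"
proof (rule bij_betw_byWitness)
  let ?inv = "\<lambda>ws. \<lambda>(x, i)\<in>P \<times> {0..n}. (ws ! i) x"
  show "\<forall>f\<in>Quilts P (chain_poset n). ?inv (layer_list n f) = f"
    by (auto simp: Quilts_chain_iff[OF n] nth_layer_list PiE_iff extensional_def fun_eq_iff)
  show *: "\<forall>ws\<in>walks (layer_step P) n (zero_layer P) (rank_layer P). layer_list n (?inv ws) = ws"
  proof
    fix ws assume "ws \<in> walks (layer_step P) n (zero_layer P) (rank_layer P)"
    then have ws: "length ws = Suc n" "hd ws = zero_layer P"
      "\<And>i. i < n \<Longrightarrow> layer_step P (ws ! i) (ws ! Suc i)"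
      by (auto simp: walks_def successively_conv_nth)
    \<comment> \<open>Extensionality makes the vertices recoverable from their values on
      \<open>P\<close>, the only ones that \<open>?inv\<close> keeps.\<close>
    have "ws ! i \<in> extensional P" if "i \<le> n" for i
    proof (cases i)
      case 0
      then show ?thesis using ws(1,2) by (cases ws) (auto simp: zero_layer_def)
    next
      case (Suc j)
      then show ?thesis using ws(3)[of j] that by (simp add: layer_step_def layers_def PiE_def)
    qed
    then show "layer_list n (?inv ws) = ws"
      by (intro nth_equalityI)
        (auto simp: ws(1) length_layer_list nth_layer_list extensional_def fun_eq_iff)
  qed
  show "layer_list n ` Quilts P (chain_poset n)
      \<subseteq> walks (layer_step P) n (zero_layer P) (rank_layer P)"
    using Quilts_chain_iff[OF n] by blast
  show "?inv ` walks (layer_step P) n (zero_layer P) (rank_layer P) \<subseteq> Quilts P (chain_poset n)"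
    using * by (auto simp: Quilts_chain_iff[OF n])
qed

text \<open>Values stay or rise by 1, so consecutive layers differ exactly when some value rises:
  the jumps are the steps that are not loops.\<close>

lemma standard_quilt_iff:
  assumes f: "f \<in> Quilts P (chain_poset (rank_sum P))"
  shows "f \<in> standard_quilts P \<longleftrightarrow> layer_list (rank_sum P) f \<in>
    walks (\<lambda>a b. layer_step P a b \<and> a \<noteq> b) (rank_sum P) (zero_layer P) (rank_layer P)"
proof -
  let ?n = "rank_sum P" and ?g = "\<lambda>i. \<lambda>x\<in>P. f (x, i)"
  have walk: "layer_list ?n f \<in> walks (layer_step P) ?n (zero_layer P) (rank_layer P)"
    using f Quilts_chain_iff[OF poset_rank_le_rank_sum[OF P]] by blast
  then have steps: "\<forall>i<?n. layer_step P (?g i) (?g (Suc i))"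
    by (auto simp: walks_def length_layer_list nth_layer_list successively_conv_nth)
  have jump: "(\<exists>x\<in>P. f (x, Suc i) = f (x, i) + 1) \<longleftrightarrow> ?g i \<noteq> ?g (Suc i)" if "i < ?n" for i
  proof -
    have "f (x, Suc i) = f (x, i) + 1 \<longleftrightarrow> f (x, i) \<noteq> f (x, Suc i)" if "x \<in> P" for x
    proof -
      have "f (x, Suc i) \<in> {f (x, i), f (x, i) + 1}"
        using steps \<open>i < ?n\<close> that by (simp add: layer_step_def)
      then show ?thesis by (elim insertE emptyE) simp_all
    qed
    then have "(\<exists>x\<in>P. f (x, Suc i) = f (x, i) + 1) \<longleftrightarrow> (\<exists>x\<in>P. f (x, i) \<noteq> f (x, Suc i))"
      by blast
    also have "\<dots> \<longleftrightarrow> ?g i \<noteq> ?g (Suc i)" by (auto simp: fun_eq_iff)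
    finally show ?thesis .
  qed
  have "f \<in> standard_quilts P \<longleftrightarrow> (\<forall>i\<in>{1..?n}. \<exists>x\<in>P. f (x, i) = f (x, i - 1) + 1)"
    using f by (auto simp: standard_quilts_def jumps_def)
  also have "\<dots> \<longleftrightarrow> (\<forall>i<?n. \<exists>x\<in>P. f (x, Suc i) = f (x, i) + 1)"
    \<comment> \<open>Jumps are numbered from 1, steps from 0.\<close>
    unfolding image_Suc_lessThan[symmetric] by (simp add: lessThan_def)
  also have "\<dots> \<longleftrightarrow> (\<forall>i<?n. ?g i \<noteq> ?g (Suc i))" using jump by blast
  finally show ?thesis using walk
    by (auto simp: walks_def length_layer_list nth_layer_list successively_conv_nth)
qed

lemma card_standard_quilts:
  "card (standard_quilts P) =
    card (walks (\<lambda>a b. layer_step P a b \<and> a \<noteq> b) (rank_sum P) (zero_layer P) (rank_layer P))"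
    (is "_ = card ?W")
proof (rule bij_betw_same_card[OF bij_betw_subset])
  let ?Q = "Quilts P (chain_poset (rank_sum P))"
  show bij: "bij_betw (layer_list (rank_sum P)) ?Q
      (walks (layer_step P) (rank_sum P) (zero_layer P) (rank_layer P))"
    by (rule bij_betw_layer_list[OF poset_rank_le_rank_sum[OF P]])
  show sub: "standard_quilts P \<subseteq> ?Q" by (auto simp: standard_quilts_def)
  \<comment> \<open>A loopless walk is in particular a walk, hence comes from a quilt.\<close>
  have "?W \<subseteq> layer_list (rank_sum P) ` ?Q"
    using bij by (auto simp: bij_betw_def walks_def elim: successively_mono)
  then show "layer_list (rank_sum P) ` standard_quilts P = ?W"
    using sub standard_quilt_iff by blast
qed

end

section \<open>The counting polynomial and its leading coefficient\<close>

theorem theorem1p1: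
  fixes P :: "'a::order set"
  assumes "ranked_poset P"
  shows "\<exists>p :: real poly.
    degree p = rank_sum P \<and>
    (\<forall>n::nat. n \<ge> poset_rank P \<longrightarrow>
       of_nat (card (Quilts P (chain_poset n))) = poly p (of_nat n)) \<and>
    lead_coeff p = of_nat (card (standard_quilts P)) / fact (rank_sum P)"
proof -
  let ?L = "\<lambda>a b. layer_step P a b \<and> a \<noteq> b"
  define s where "s k = card (walks ?L k (zero_layer P) (rank_layer P))" for k
  have fin: "finite {h. layer_step P g h}" for g by (rule finite_layer_steps[OF assms])
  \<comment> \<open>The deficit is the potential; it equals \<open>rank_sum P\<close> at the zero
    layer.\<close>
  have "s k = 0" if "k > rank_sum P" for k
    using walk_length_le[of ?L "deficit P" k "zero_layer P" "rank_layer P"] that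
      deficit_layer_step[OF assms] deficit_zero_layer[OF assms]
    by (fastforce simp: s_def)
  \<comment> \<open>This makes the degree exactly \<open>rank_sum P\<close>.\<close>
  moreover have "s (rank_sum P) > 0"
  proof -
    have "finite (walks ?L n g h)" for n g h
      by (rule finite_walks) (rule finite_subset[OF _ fin], auto)
    then show ?thesis
      using ex_full_walk[OF assms zero_layer[OF assms]]
      by (simp add: s_def card_gt_0_iff deficit_zero_layer[OF assms])
  qed
  ultimately obtain p :: "real poly" where p: "degree p = rank_sum P"
    "\<And>n. of_nat (\<Sum>k\<le>n. (n choose k) * s k) = poly p (of_nat n)"
    "lead_coeff p = of_nat (s (rank_sum P)) / fact (rank_sum P)"
    using binomial_sum_polynomial[of "rank_sum P" s, where 'a = real] by blast
  have "card (Quilts P (chain_poset n)) = (\<Sum>k\<le>n. (n choose k) * s k)"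
    if "n \<ge> poset_rank P" for n
    unfolding s_def bij_betw_same_card[OF bij_betw_layer_list[OF assms that]]
    \<comment> \<open>Every layer carries a loop, since \<open>layer_step\<close> allows all values
      to stay.\<close>
    by (rule card_walks_eq_sum_loopless[OF fin])
      (use zero_layer[OF assms] in \<open>auto simp: layer_step_def\<close>)
  moreover have "card (standard_quilts P) = s (rank_sum P)"
    by (simp add: card_standard_quilts[OF assms] s_def)
  ultimately show ?thesis using p by (intro exI[of _ p]) simp
qed

end
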